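(* Suppose that the amplitude $\mathcal A\in\mathbb R_+^{n\times n}$ is nonzero everywhere (in every entry). Then the set $\chi=\{(E_c\cdot\mathcal A\cdot e^{\mathrm j\Phi})_{c\in\mathcal I}\in\mathcal H:\Phi\in\mathbb R^{n\times n}\}$ is prox-regular.
   Context: Let $n\ge1$ be an integer. Products, exponentials and equalities of $n\times n$ arrays are elementwise; $\mathrm j=\sqrt{-1}$; indices are $\xi=(\xi_1,\xi_2)$, $1\le\xi_1,\xi_2\le n$, and $w[\xi]$ is the entry of $w$ at $\xi$. Let $\mathcal I=\{XX,XY,XZ,YX,YY,YZ\}$ and $\mathcal H=(\mathbb C^{n\times n})^6$, with elements $x=(x_c)_{c\in\mathcal I}$, with Frobenius norm $\|x\|^2=\sum_{c\in\mathcal I}\sum_\xi|x_c[\xi]|^2$. For $\Omega\subset\mathcal H$, $P_\Omega(x)=\{w\in\Omega:\|x-w\|=\inf_{v\in\Omega}\|x-v\|\}$. The matrices $E_c$: for every index $\xi$ (sampling point of the lens aperture) let $(k_X,k_Y,k_Z)=(k_X[\xi],k_Y[\xi],k_Z[\xi])\in\mathbb R^3$ be a unit vector (the unit wave vector) with $1+k_Z\neq0$. The real $n\times n$ matrices $E_c$ are given entrywise by $E_{XX}=1-\frac{k_X^2}{1+k_Z}$, $E_{XY}=E_{YX}=-\frac{k_Xk_Y}{1+k_Z}$, $E_{YY}=1-\frac{k_Y^2}{1+k_Z}$, $E_{XZ}=-k_X$, $E_{YZ}=-k_Y$; they satisfy $\sum_{c\in\mathcal I}E_c^2=2$ in every entry.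 Definition (prox-regularity). A set $\Omega$ is prox-regular at a point $\hat x\in\Omega$ if its projector $P_\Omega$ is single-valued around $\hat x$, i.e. on some neighborhood of $\hat x$; $\Omega$ is prox-regular if it is prox-regular at every one of its points. *)

theory Defs
  imports "HOL-Analysis.Analysis"
begin

datatype chan = XX | XY | XZ | YX | YY | YZ

lemma UNIV_chan: "(UNIV :: chan set) = {XX, XY, XZ, YX, YY, YZ}"
  by (auto intro: chan.exhaust)

instance chan :: finite
  by standard (simp add: UNIV_chan)

text \<open>
  The space of six complex matrices indexed by the channels. An index \<open>\<xi>\<close> is a pair of
  elements of \<open>'n\<close>, where \<open>CARD('n)\<close> is the (arbitrary, positive) matrix size.
\<close>

type_synonym 'n field6 = "complex ^ 'n ^ 'n ^ chan"

text \<open>The library norm of this type is the Frobenius norm.\<close>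

lemma field6_norm_sq:
  fixes x :: "'n::finite field6"
  shows "(norm x)\<^sup>2 = (\<Sum>c\<in>UNIV. \<Sum>i\<in>UNIV. \<Sum>j\<in>UNIV. (cmod (x $ c $ i $ j))\<^sup>2)"
  by (simp add: norm_vec_def L2_set_def sum_nonneg)

definition projector :: "'a::real_normed_vector set \<Rightarrow> 'a \<Rightarrow> 'a set" where
  "projector \<Omega> x = {w \<in> \<Omega>. norm (x - w) = (INF v\<in>\<Omega>. norm (x - v))}"

definition prox_regular_at :: "'a::real_normed_vector set \<Rightarrow> 'a \<Rightarrow> bool" where
  "prox_regular_at \<Omega> x0 \<longleftrightarrow>
     x0 \<in> \<Omega> \<and> (\<exists>U. open U \<and> x0 \<in> U \<and> (\<forall>x\<in>U. \<exists>!w. w \<in> projector \<Omega> x))"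

definition prox_regular :: "'a::real_normed_vector set \<Rightarrow> bool" where
  "prox_regular \<Omega> \<longleftrightarrow> (\<forall>x0\<in>\<Omega>. prox_regular_at \<Omega> x0)"

text \<open>Components \<open>1\<close>, \<open>2\<close>, \<open>3\<close> of a wave vector in \<open>real ^ 3\<close> are its X, Y, Z components.\<close>

fun pol_coeff :: "chan \<Rightarrow> real ^ 3 \<Rightarrow> real" where
  "pol_coeff XX q = 1 - (q $ 1)\<^sup>2 / (1 + q $ 3)"
| "pol_coeff XY q = - (q $ 1 * q $ 2) / (1 + q $ 3)"
| "pol_coeff XZ q = - (q $ 1)"
| "pol_coeff YX q = - (q $ 1 * q $ 2) / (1 + q $ 3)"
| "pol_coeff YY q = 1 - (q $ 2)\<^sup>2 / (1 + q $ 3)"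
| "pol_coeff YZ q = - (q $ 2)"

definition pol_matrix :: "real ^ 3 ^ 'n ^ 'n \<Rightarrow> chan \<Rightarrow> real ^ 'n ^ 'n" where
  "pol_matrix k c = (\<chi> i j. pol_coeff c (k $ i $ j))"

lemma pol_coeff_sum_sq:
  assumes "norm q = 1" and "1 + q $ 3 \<noteq> 0"
  shows "(\<Sum>c\<in>UNIV. (pol_coeff c q)\<^sup>2) = 2"
proof -
  define a b d where "a = q $ 1" and "b = q $ 2" and "d = 1 + q $ 3"
  have "(norm q)\<^sup>2 = a\<^sup>2 + b\<^sup>2 + (d - 1)\<^sup>2"
    by (simp add: norm_vec_def L2_set_def sum_3 a_def b_def d_def)
  then have ab: "a\<^sup>2 + b\<^sup>2 = d * (2 - d)"
    using assms(1) by (simp add: power2_eq_square algebra_simps)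
  have d: "d \<noteq> 0" using assms(2) by (simp add: d_def)
  have "(\<Sum>c\<in>UNIV. (pol_coeff c q)\<^sup>2)
      = 2 - 2 * ((a\<^sup>2 + b\<^sup>2) / d) + ((a\<^sup>2 + b\<^sup>2) / d)\<^sup>2 + (a\<^sup>2 + b\<^sup>2)"
    using d unfolding UNIV_chan
    by (simp flip: a_def b_def d_def add: field_simps power2_eq_square)
  also have "\<dots> = 2 - 2 * (2 - d) + (2 - d)\<^sup>2 + d * (2 - d)"
    unfolding ab using d by simp
  also have "\<dots> = 2" by (simp add: power2_eq_square algebra_simps)
  finally show ?thesis .
qed

definition phase_set :: "real ^ 3 ^ 'n ^ 'n \<Rightarrow> real ^ 'n ^ 'n \<Rightarrow> ('n::finite) field6 set" where
  "phase_set k A =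
     {(\<chi> c i j. complex_of_real (pol_matrix k c $ i $ j) * complex_of_real (A $ i $ j)
                 * exp (\<i> * complex_of_real (\<Phi> $ i $ j))) | \<Phi> :: real ^ 'n ^ 'n. True}"

end

theory Submission
  imports Defs
begin

text \<open>
  A point of the phase set is determined by unit complex numbers \<open>u[\<xi>]\<close>, one per sampling point,
  so its squared distance to \<open>x\<close> is a sum over \<open>\<xi>\<close> of terms in which the \<open>u[\<xi>]\<close> are
  decoupled. Since the \<open>E\<^sub>c\<close> are real, expanding the squares turns the term at \<open>\<xi>\<close> into a
  quantity independent of the phases minus \<open>2 A[\<xi>] Re (cnj u[\<xi>] s[\<xi>])\<close>, where
  \<open>s[\<xi>] = (\<Sum>c. E\<^sub>c[\<xi>] x\<^sub>c[\<xi>])\<close> is the correlation of \<open>x\<close> with the coefficients. When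
  \<open>s[\<xi>] \<noteq> 0\<close>, the real part is largest exactly at the phase \<open>sgn s[\<xi>]\<close>, and passing from it to
  another phase costs \<open>A[\<xi>] |s[\<xi>]| |u[\<xi>] - sgn s[\<xi>]|\<^sup>2\<close> (lemma \<open>channel_dist_sq\<close>). Summing
  over \<open>\<xi>\<close> gives a Pythagoras-like identity (lemma \<open>phase_field_dist_sq\<close>), so for a positive
  amplitude the projection of \<open>x\<close> exists and is unique as soon as every correlation is nonzero.

  Having nonzero correlations is an open condition on \<open>x\<close>. It holds on the phase set itself, since
  there \<open>s[\<xi>] = (\<Sum>c. E\<^sub>c[\<xi>]\<^sup>2) A[\<xi>] u[\<xi>] = 2 A[\<xi>] u[\<xi>]\<close>. At an entry where the amplitude
  vanished, this correlation would be zero.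
\<close>

lemma ex1_projector_if_strictly_nearest:
  assumes "w \<in> \<Omega>" and nearest: "\<And>v. v \<in> \<Omega> \<Longrightarrow> v \<noteq> w \<Longrightarrow> norm (x - w) < norm (x - v)"
  shows "\<exists>!v. v \<in> projector \<Omega> x"
proof -
  have "(INF v\<in>\<Omega>. norm (x - v)) = norm (x - w)"
    using assms by (intro cInf_eq_minimum) (auto intro: less_imp_le)
  then have "v \<in> projector \<Omega> x \<longleftrightarrow> v = w" for v
    unfolding projector_def using assms by (cases "v = w") force+
  then show ?thesis
    by simp
qed

text \<open>
  The unit complex number \<open>u\<close>, rather than its real phase, serves as the parameter: the map is
  then linear in \<open>u\<close>, and the \<open>2\<pi>\<close>-ambiguity of phases disappears.
\<close>

definition phase_field ::
    "real ^ 3 ^ 'n ^ 'n \<Rightarrow> real ^ 'n ^ 'n \<Rightarrow> ('n \<Rightarrow> 'n \<Rightarrow> complex) \<Rightarrow> ('n::finite) field6" where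
  "phase_field k A u = (\<chi> c i j. of_real (pol_matrix k c $ i $ j) * of_real (A $ i $ j) * u i j)"

definition correlation :: "real ^ 3 ^ 'n ^ 'n \<Rightarrow> ('n::finite) field6 \<Rightarrow> 'n \<Rightarrow> 'n \<Rightarrow> complex" where
  "correlation k x i j = (\<Sum>c\<in>UNIV. of_real (pol_matrix k c $ i $ j) * x $ c $ i $ j)"

lemma phase_set_eq_image:
  "phase_set k A = phase_field k A ` {u. \<forall>i j. cmod (u i j) = 1}"
proof (intro equalityI subsetI)
  fix w assume "w \<in> phase_set k A"
  then obtain \<Phi> :: "real ^ 'a ^ 'a"
    where "w = phase_field k A (\<lambda>i j. exp (\<i> * of_real (\<Phi> $ i $ j)))"
    unfolding phase_set_def phase_field_def by blast
  then show "w \<in> phase_field k A ` {u. \<forall>i j. cmod (u i j) = 1}"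
    by auto
next
  fix w assume "w \<in> phase_field k A ` {u. \<forall>i j. cmod (u i j) = 1}"
  then obtain u where u: "\<And>i j. cmod (u i j) = 1" and w: "w = phase_field k A u"
    by auto
  define \<Phi> :: "real ^ 'a ^ 'a" where "\<Phi> = (\<chi> i j. Arg (u i j))"
  have "exp (\<i> * of_real (\<Phi> $ i $ j)) = u i j" for i j
    using Arg_eq[of "u i j"] u[of i j] by (force simp: \<Phi>_def)
  then show "w \<in> phase_set k A"
    unfolding phase_set_def w phase_field_def by (intro CollectI exI[of _ \<Phi>]) simp
qed

text \<open>
  The squared distance is quadratic in \<open>u\<close> with the same quadratic part for all unit \<open>u\<close>, so only
  the term linear in \<open>u\<close> matters; for unit \<open>u\<close> it is controlled by the parallelogram-type identity
  \<open>2 Re (cnj u (sgn s)) = 2 - |u - sgn s|\<^sup>2\<close>.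
\<close>

lemma channel_dist_sq:
  fixes e :: "'c \<Rightarrow> real" and z :: "'c \<Rightarrow> complex" and a :: real and I :: "'c set"
  defines "s \<equiv> (\<Sum>c\<in>I. of_real (e c) * z c)"
  assumes u: "cmod u = 1" and "s \<noteq> 0"
  shows "(\<Sum>c\<in>I. (cmod (z c - of_real (e c) * of_real a * u))\<^sup>2) =
    (\<Sum>c\<in>I. (cmod (z c - of_real (e c) * of_real a * sgn s))\<^sup>2) + a * cmod s * (cmod (u - sgn s))\<^sup>2"
proof -
  have expand: "(\<Sum>c\<in>I. (cmod (z c - of_real (e c) * of_real a * v))\<^sup>2) =
      (\<Sum>c\<in>I. (cmod (z c))\<^sup>2) + a\<^sup>2 * (\<Sum>c\<in>I. (e c)\<^sup>2) - 2 * a * Re (cnj v * s)"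
    if v: "cmod v = 1" for v
  proof -
    have v2: "(Re v)\<^sup>2 + (Im v)\<^sup>2 = 1"
      using v by (metis cmod_power2 one_power2)
    have "(cmod (z c - of_real (e c) * of_real a * v))\<^sup>2 =
        (cmod (z c))\<^sup>2 + a\<^sup>2 * (e c)\<^sup>2 - 2 * a * Re (cnj v * (of_real (e c) * z c))" for c
    proof -
      have "(cmod (z c - of_real (e c) * of_real a * v))\<^sup>2 =
          (cmod (z c))\<^sup>2 + a\<^sup>2 * (e c)\<^sup>2 * ((Re v)\<^sup>2 + (Im v)\<^sup>2)
            - 2 * a * Re (cnj v * (of_real (e c) * z c))"
        unfolding cmod_power2 by (simp add: power2_eq_square algebra_simps)
      then show ?thesis using v2 by simp
    qed
    then show ?thesis
      by (simp only: s_def sum.distrib sum_subtractf sum_distrib_left Re_sum)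
  qed
  have sgn: "cmod (sgn s) = 1"
    using \<open>s \<noteq> 0\<close> by (simp add: norm_sgn)
  have s: "s = of_real (cmod s) * sgn s"
    using \<open>s \<noteq> 0\<close> by (simp add: sgn_eq)
  have phase_loss: "2 * Re (cnj v * s) = cmod s * (2 - (cmod (v - sgn s))\<^sup>2)"
    if v: "cmod v = 1" for v
  proof -
    have "(cmod (v - sgn s))\<^sup>2 = (cmod v)\<^sup>2 + (cmod (sgn s))\<^sup>2 - 2 * Re (cnj v * sgn s)"
      unfolding cmod_power2 by (simp add: power2_eq_square algebra_simps)
    then have "2 * Re (cnj v * sgn s) = 2 - (cmod (v - sgn s))\<^sup>2"
      using v sgn by simp
    moreover have "Re (cnj v * s) = cmod s * Re (cnj v * sgn s)"
      by (subst s) (simp add: algebra_simps)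
    ultimately show ?thesis
      by algebra
  qed
  have "2 * Re (cnj (sgn s) * s) = 2 * cmod s"
    by (subst phase_loss[OF sgn]) simp
  with phase_loss[OF u]
  have "2 * a * Re (cnj u * s) + a * cmod s * (cmod (u - sgn s))\<^sup>2 = 2 * a * Re (cnj (sgn s) * s)"
    by algebra
  then show ?thesis
    using expand[OF u] expand[OF sgn] by linarith
qed

lemma phase_field_dist_sq:
  fixes k :: "real ^ 3 ^ 'n::finite ^ 'n"
  assumes u: "\<And>i j. cmod (u i j) = 1" and s: "\<And>i j. correlation k x i j \<noteq> 0"
  shows "(norm (x - phase_field k A u))\<^sup>2 =
    (norm (x - phase_field k A (\<lambda>i j. sgn (correlation k x i j))))\<^sup>2 +
    (\<Sum>i\<in>UNIV. \<Sum>j\<in>UNIV. A $ i $ j * cmod (correlation k x i j)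
       * (cmod (u i j - sgn (correlation k x i j)))\<^sup>2)"
proof -
  have by_entry: "(norm (x - phase_field k A v))\<^sup>2 = (\<Sum>i\<in>UNIV. \<Sum>j\<in>UNIV. \<Sum>c\<in>UNIV.
      (cmod (x $ c $ i $ j - of_real (pol_matrix k c $ i $ j) * of_real (A $ i $ j) * v i j))\<^sup>2)"
    for v
    unfolding field6_norm_sq
    by (subst sum.swap, intro sum.cong refl, subst sum.swap) (simp add: phase_field_def)
  show ?thesis
    unfolding by_entry sum.distrib[symmetric]
    using channel_dist_sq[OF u s[unfolded correlation_def]]
    by (simp add: correlation_def)
qed

lemma ex1_projector_phase_set:
  fixes k :: "real ^ 3 ^ 'n::finite ^ 'n"
  assumes A: "\<And>i j. A $ i $ j > 0" and s: "\<And>i j. correlation k x i j \<noteq> 0"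
  shows "\<exists>!w. w \<in> projector (phase_set k A) x"
proof (rule ex1_projector_if_strictly_nearest)
  define s' where "s' = (\<lambda>i j. sgn (correlation k x i j))"
  show "phase_field k A s' \<in> phase_set k A"
    unfolding phase_set_eq_image using s by (auto simp: s'_def norm_sgn)
  fix v assume "v \<in> phase_set k A" and ne: "v \<noteq> phase_field k A s'"
  then obtain u where u: "\<And>i j. cmod (u i j) = 1" and v: "v = phase_field k A u"
    unfolding phase_set_eq_image by auto
  from ne v obtain i j where ij: "u i j \<noteq> s' i j"
    by (metis ext)
  define loss where
    "loss i j = A $ i $ j * cmod (correlation k x i j) * (cmod (u i j - s' i j))\<^sup>2" for i j
  have loss_nonneg: "loss i j \<ge> 0" for i j
    using A[of i j] by (simp add: loss_def)
  have pos: "0 < loss i j"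
    using A[of i j] s[of i j] ij by (simp add: loss_def)
  have pos_row: "0 < (\<Sum>j\<in>UNIV. loss i j)"
    by (intro sum_pos2[where f = "loss i" and i = j, OF finite UNIV_I pos] loss_nonneg)
  have "0 < (\<Sum>i\<in>UNIV. \<Sum>j\<in>UNIV. loss i j)"
    by (intro sum_pos2[where f = "\<lambda>i. sum (loss i) UNIV" and i = i, OF finite UNIV_I pos_row]
        sum_nonneg loss_nonneg)
  moreover have "(norm (x - v))\<^sup>2 = (norm (x - phase_field k A s'))\<^sup>2 + (\<Sum>i\<in>UNIV. \<Sum>j\<in>UNIV. loss i j)"
    unfolding v loss_def s'_def by (rule phase_field_dist_sq[OF u s])
  ultimately show "norm (x - phase_field k A s') < norm (x - v)"
    by (auto intro: power_less_imp_less_base[of _ 2])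
qed

lemma correlation_phase_field:
  assumes "norm (k $ i $ j) = 1" and "1 + k $ i $ j $ 3 \<noteq> 0"
  shows "correlation k (phase_field k A u) i j = 2 * of_real (A $ i $ j) * u i j"
proof -
  have "correlation k (phase_field k A u) i j =
      of_real (\<Sum>c\<in>UNIV. (pol_coeff c (k $ i $ j))\<^sup>2) * (of_real (A $ i $ j) * u i j)"
    unfolding correlation_def phase_field_def pol_matrix_def of_real_sum sum_distrib_right
    by (simp add: power2_eq_square mult.assoc)
  then show ?thesis
    using pol_coeff_sum_sq[OF assms] by simp
qed

lemma open_correlation_nonzero:
  fixes k :: "real ^ 3 ^ 'n::finite ^ 'n"
  shows "open {x. \<forall>i j. correlation k x i j \<noteq> 0}"
proof -
  have "open {x. correlation k x i j \<noteq> 0}" for i j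
    unfolding correlation_def by (intro open_Collect_neq continuous_intros)
  moreover have "{x. \<forall>i j. correlation k x i j \<noteq> 0} = (\<Inter>i. \<Inter>j. {x. correlation k x i j \<noteq> 0})"
    by auto
  ultimately show ?thesis
    by (simp add: open_INT)
qed

theorem proposition5p6:
  fixes k :: "real ^ 3 ^ 'n::finite ^ 'n" and A :: "real ^ 'n ^ 'n"
  assumes unit: "\<And>i j. norm (k $ i $ j) = 1"
    and kZ: "\<And>i j. 1 + k $ i $ j $ 3 \<noteq> 0"
    and A_nonneg: "\<And>i j. A $ i $ j \<ge> 0"
    and A_nonzero: "\<And>i j. A $ i $ j \<noteq> 0"
  shows "prox_regular (phase_set k A)"
  unfolding prox_regular_def prox_regular_at_def
proof (intro ballI conjI exI)
  have A_pos: "A $ i $ j > 0" for i j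
    using A_nonneg[of i j] A_nonzero[of i j] by simp
  let ?U = "{x. \<forall>i j. correlation k x i j \<noteq> 0}"
  fix x0 assume x0: "x0 \<in> phase_set k A"
  then show "x0 \<in> phase_set k A" .
  show "open ?U"
    by (rule open_correlation_nonzero)
  obtain u where u: "\<And>i j. cmod (u i j) = 1" and "x0 = phase_field k A u"
    using x0 unfolding phase_set_eq_image by auto
  moreover have "u i j \<noteq> 0" for i j
    using u[of i j] by auto
  ultimately show "x0 \<in> ?U"
    using A_nonzero by (simp add: correlation_phase_field[OF unit kZ])
  show "\<exists>!w. w \<in> projector (phase_set k A) x" if "x \<in> ?U" for x
    using that by (intro ex1_projector_phase_set A_pos) simp
qed

end
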